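(* Let $t\ge 1$ be an integer and $\varepsilon>0$. Let $\mathcal{A}$ be the randomized algorithm which, on input a sequence $V=(V_1,\dots,V_t)$ of finite directed graphs, outputs $D=(D_1,\dots,D_t)$, where for each $j\in\{1,\dots,t\}$ $$D_j=\mathcal{P}\Big(\sum_{u}\deg_{V_j}(u)+Y_j\Big),\qquad Y_j\sim\mathrm{Laplace}(t/\varepsilon),$$ the sum running over all nodes $u$ of $V_j$, the noises $Y_1,\dots,Y_t$ being independent, and $\mathcal{P}(x)$ being the integer closest to $x$ if $x>0$ and $\mathcal{P}(x)=0$ otherwise. Then $\mathcal{A}$ is $\varepsilon$-edge-differentially private: for every pair of edge-neighboring inputs $V,V'$ and every set $S$ of outputs, $$\mathbb{P}(\mathcal{A}(V)\in S)\le e^{\varepsilon}\,\mathbb{P}(\mathcal{A}(V')\in S).$$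
   Context: Graphs are finite directed graphs without multiple edges: nodes represent users of a local area network, and a directed edge from $s$ to $r$ in $V_j$ means that user $s$ sent at least one ARP request to user $r$ during week $j$. The degree $\deg_G(u)$ of a node $u$ in $G$ is its out-degree, i.e. the number of directed edges of $G$ originating from $u$. $\mathrm{Laplace}(b)$ is the Laplace distribution with mean $0$ and scale $b$. In $\mathcal{P}$, ties in rounding are broken by any fixed deterministic rule. Two graphs are edge-neighboring if they differ by a single edge (same node set, and one is obtained from the other by removing exactly one directed edge). Two input sequences $V=(V_1,\dots,V_t)$ and $V'=(V'_1,\dots,V'_t)$ are edge-neighboring if for each $j$ the graphs $V_j$ and $V'_j$ are either equal or edge-neighboring. *)

theory Defs
  imports "HOL-Probability.Probability" "Graph_Theory.Pair_Digraph"
begin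

definition laplace_density :: "real \<Rightarrow> real \<Rightarrow> real" where
  "laplace_density b x = exp (- \<bar>x\<bar> / b) / (2 * b)"

definition laplace :: "real \<Rightarrow> real measure" where
  "laplace b = density lborel (\<lambda>x. ennreal (laplace_density b x))"

(* A half-integer x > 0 has two closest integers; any function P choosing one of them is
   allowed, so that no tie-breaking rule is singled out. *)
definition nonneg_rounding :: "(real \<Rightarrow> int) \<Rightarrow> bool" where
  "nonneg_rounding P \<longleftrightarrow>
     (\<forall>x>0. \<forall>k::int. \<bar>x - of_int (P x)\<bar> \<le> \<bar>x - of_int k\<bar>) \<and> (\<forall>x\<le>0. P x = 0)"

definition edge_neighboring :: "'a pair_pre_digraph \<Rightarrow> 'a pair_pre_digraph \<Rightarrow> bool" where
  "edge_neighboring G H \<longleftrightarrow> pverts G = pverts H \<and>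
     ((\<exists>e\<in>parcs G. parcs H = parcs G - {e}) \<or> (\<exists>e\<in>parcs H. parcs G = parcs H - {e}))"

(* Loops are allowed; parallel arcs are excluded by the representation of arcs as pairs. *)
definition graph_seqs :: "nat \<Rightarrow> 'a pair_pre_digraph list set" where
  "graph_seqs t = {V. length V = t \<and> (\<forall>G\<in>set V. pair_fin_digraph G)}"

definition edge_neighboring_seqs ::
  "'a pair_pre_digraph list \<Rightarrow> 'a pair_pre_digraph list \<Rightarrow> bool" where
  "edge_neighboring_seqs V V' \<longleftrightarrow> list_all2 (\<lambda>G H. G = H \<or> edge_neighboring G H) V V'"

(* A randomized algorithm is given by the distribution of its output on each input. *)
definition edge_differentially_private ::
  "nat \<Rightarrow> real \<Rightarrow> ('a pair_pre_digraph list \<Rightarrow> int list measure) \<Rightarrow> bool" where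
  "edge_differentially_private t \<epsilon> A \<longleftrightarrow>
     (\<forall>V\<in>graph_seqs t. \<forall>V'\<in>graph_seqs t. edge_neighboring_seqs V V' \<longrightarrow>
        (\<forall>S. measure (A V) S \<le> exp \<epsilon> * measure (A V') S))"

(* The joint law of independent noises is the product measure; positions are numbered from 0. *)
definition noisy_edge_counts ::
  "nat \<Rightarrow> real \<Rightarrow> (real \<Rightarrow> int) \<Rightarrow> 'a pair_pre_digraph list \<Rightarrow> int list measure" where
  "noisy_edge_counts t \<epsilon> P V =
     distr (PiM {..<t} (\<lambda>_. laplace (real t / \<epsilon>))) (count_space UNIV)
       (\<lambda>Y. map (\<lambda>j. P (real (\<Sum>u\<in>pverts (V ! j). out_degree (with_proj (V ! j)) u) + Y j)) [0..<t])"

(* The following lemmas confirm that the above are genuine probability measures (a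
   non-measurable map would make the image measure zero) and that every set of outputs
   is an event. *)

lemma sets_laplace [simp, measurable_cong]: "sets (laplace b) = sets borel"
  by (simp add: laplace_def)

lemma prob_space_laplace:
  assumes "b > 0"
  shows "prob_space (laplace b)"
proof
  let ?e = "exponential_density (1 / b)"
  interpret E: prob_space "density lborel ?e"
    using assms by (intro prob_space_exponential_density) simp
  have meas: "?e \<in> borel_measurable borel"
    by measurable
  have e1: "(\<integral>\<^sup>+x. ennreal (?e x) \<partial>lborel) = 1"
    using E.emeasure_space_1 by (simp add: emeasure_density)
  have "(\<integral>\<^sup>+x. ennreal (?e x) \<partial>lborel) =
      ennreal \<bar>-1\<bar> * (\<integral>\<^sup>+x. ennreal (?e (0 + (-1) * x)) \<partial>lborel)"
    by (intro nn_integral_real_affine) auto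
  hence e2: "(\<integral>\<^sup>+x. ennreal (?e (- x)) \<partial>lborel) = 1"
    using e1 by simp
  have nn: "?e x \<ge> 0" for x
    using assms by (simp add: exponential_density_def)
  have "emeasure (laplace b) (space (laplace b)) =
      (\<integral>\<^sup>+x. ennreal (laplace_density b x) \<partial>lborel)"
    by (simp add: laplace_def emeasure_density laplace_density_def)
  also have "\<dots> = (\<integral>\<^sup>+x. ennreal (1/2) * (ennreal (?e x) + ennreal (?e (- x))) \<partial>lborel)"
  proof (rule nn_integral_cong_AE)
    show "AE x in lborel. ennreal (laplace_density b x) =
        ennreal (1/2) * (ennreal (?e x) + ennreal (?e (- x)))"
      using AE_lborel_singleton[of 0]
    proof eventually_elim
      case (elim x)
      have "laplace_density b x = 1/2 * (?e x + ?e (- x))"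
        using elim assms by (simp add: laplace_density_def exponential_density_def)
      hence "ennreal (laplace_density b x) = ennreal (1/2) * ennreal (?e x + ?e (- x))"
        using nn by (simp only: ennreal_mult')
      thus ?case
        using nn by (simp only: ennreal_plus)
    qed
  qed
  also have "\<dots> = ennreal (1/2) * (\<integral>\<^sup>+x. ennreal (?e x) + ennreal (?e (- x)) \<partial>lborel)"
    by (rule nn_integral_cmult) measurable
  also have "(\<integral>\<^sup>+x. ennreal (?e x) + ennreal (?e (- x)) \<partial>lborel) = 1 + 1"
    by (subst nn_integral_add) (auto simp: e1 e2)
  also have "(1 + 1 :: ennreal) = ennreal 2"
    by simp
  also have "ennreal (1/2) * ennreal 2 = 1"
    by (subst ennreal_mult[symmetric]) simp_all
  finally show "emeasure (laplace b) (space (laplace b)) = 1" .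
qed

lemma measurable_nonneg_rounding:
  assumes "nonneg_rounding P"
  shows "P \<in> measurable borel (count_space UNIV)"
proof -
  have near: "\<bar>x - of_int (P x)\<bar> \<le> \<bar>x - of_int k\<bar>" if "x > 0" for x and k :: int
    using assms that by (simp add: nonneg_rounding_def)
  have zero: "P x = 0" if "x \<le> 0" for x
    using assms that by (simp add: nonneg_rounding_def)
  have nn: "P x \<ge> 0" for x
    using near[of x 0] zero[of x] by (cases "x > 0") (auto simp: abs_if split: if_splits)
  have "P x \<le> P y" if "x \<le> y" for x y
  proof (cases "x \<le> 0 \<or> x = y")
    case True
    then show ?thesis using zero[of x] nn by auto
  next
    case False
    then show ?thesis
      using near[of x "P y"] near[of y "P x"] that
      by (cases "P x \<le> P y") (auto simp: abs_if not_le split: if_splits)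
  qed
  hence "mono (\<lambda>x. real_of_int (P x))"
    by (auto intro!: monoI)
  hence meas: "(\<lambda>x. real_of_int (P x)) \<in> borel_measurable borel"
    by (rule borel_measurable_mono)
  have "P = (\<lambda>x. \<lfloor>real_of_int (P x)\<rfloor>)"
    by simp
  also have "\<dots> \<in> measurable borel (count_space UNIV)"
    using meas by measurable
  finally show ?thesis .
qed

lemma sets_noisy_edge_counts [simp]: "sets (noisy_edge_counts t \<epsilon> P V) = UNIV"
  by (simp add: noisy_edge_counts_def)

lemma prob_space_noisy_edge_counts:
  assumes "t \<ge> 1" and "\<epsilon> > 0" and "nonneg_rounding P"
  shows "prob_space (noisy_edge_counts t \<epsilon> P V)"
proof -
  let ?M = "PiM {..<t} (\<lambda>_. laplace (real t / \<epsilon>))"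
  define c where "c j = real (\<Sum>u\<in>pverts (V ! j). out_degree (with_proj (V ! j)) u)" for j
  have "prob_space ?M"
    using assms by (intro prob_space_PiM prob_space_laplace) auto
  moreover have "(\<lambda>Y. map (\<lambda>j. P (c j + Y j)) [0..<t]) \<in> measurable ?M (count_space UNIV)"
  proof -
    have "(\<lambda>Y. map (\<lambda>j. P (c j + Y j)) [0..<t]) -` {xs} \<inter> space ?M \<in> sets ?M" for xs
    proof -
      have "(\<lambda>Y. map (\<lambda>j. P (c j + Y j)) [0..<t]) -` {xs} \<inter> space ?M =
          {Y\<in>space ?M. length xs = t \<and> (\<forall>j\<in>{..<t}. P (c j + Y j) = xs ! j)}"
        by (rule set_eqI) (simp add: list_eq_iff_nth_eq, blast)
      also have "\<dots> \<in> sets ?M"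
      proof (intro sets.sets_Collect sets.sets_Collect_finite_All)
        fix j assume "j \<in> {..<t}"
        hence "(\<lambda>Y. Y j) \<in> measurable ?M borel"
          using measurable_component_singleton[of j "{..<t}" "\<lambda>_. laplace (real t / \<epsilon>)"] by simp
        hence "(\<lambda>Y. c j + Y j) \<in> measurable ?M borel"
          by measurable
        hence "(\<lambda>Y. P (c j + Y j)) \<in> measurable ?M (count_space UNIV)"
          using measurable_nonneg_rounding[OF assms(3)] by (rule measurable_compose)
        hence "(\<lambda>Y. P (c j + Y j)) -` {xs ! j} \<inter> space ?M \<in> sets ?M"
          by (rule measurable_sets) simp
        thus "{Y\<in>space ?M. P (c j + Y j) = xs ! j} \<in> sets ?M"
          by (simp add: vimage_def Int_def conj_commute)
      qed auto
      finally show ?thesis .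
    qed
    thus ?thesis
      by (simp add: measurable_count_space_eq2_countable)
  qed
  ultimately show ?thesis
    unfolding noisy_edge_counts_def c_def by (rule prob_space.prob_space_distr)
qed

end

theory Submission
  imports Defs
begin

text \<open>The degree sum of a graph is its number of edges, so neighboring inputs have degree sums
  differing by at most 1 in each week. Shifting the Laplace distribution of scale \<open>t / \<epsilon>\<close> by at most 1
  changes its density by a factor of at most \<open>exp (\<epsilon> / t)\<close>. Outputs are countable, so it suffices to
  compare the probabilities of single outputs; these are products of t factors by independence.\<close>

text \<open>Every arc is counted exactly once, at its tail, which lies in the finite set
  \<open>pverts G\<close>.\<close>

lemma sum_out_degree_eq_card_parcs:
  assumes "pair_fin_digraph G"
  shows "(\<Sum>u\<in>pverts G. out_degree (with_proj G) u) = card (parcs G)"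
proof -
  interpret pair_fin_digraph G by fact
  have "(\<Sum>u\<in>pverts G. out_degree (with_proj G) u) =
      (\<Sum>u\<in>pverts G. \<Sum>e | e \<in> parcs G \<and> fst e = u. 1)"
    by (simp add: out_degree_def out_arcs_def)
  also have "\<dots> = (\<Sum>e\<in>parcs G. 1)"
    by (rule sum.group) (auto intro: in_arcsD1)
  finally show ?thesis by simp
qed

lemma abs_diff_card_parcs_le_1:
  assumes "edge_neighboring G H" "finite (parcs G)" "finite (parcs H)"
  shows "\<bar>real (card (parcs G)) - real (card (parcs H))\<bar> \<le> 1"
proof -
  \<comment> \<open>This is the case where the second graph loses an arc; the other case is its
    mirror image under the symmetry of the absolute value.\<close>
  have "\<bar>real (card A) - real (card (A - {e}))\<bar> \<le> 1" if "finite A" "e \<in> A"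
    for A :: "('a \<times> 'a) set" and e
    using card.remove[OF that] by simp
  thus ?thesis
    using assms by (auto simp: edge_neighboring_def abs_minus_commute)
qed

text \<open>This is the triangle inequality \<open>|x - c'| <= |x - c| + |c - c'|\<close>, divided
  by \<open>b\<close> and exponentiated.\<close>

lemma laplace_density_shift_le:
  assumes "b > 0"
  shows "laplace_density b (x - c) \<le> exp (\<bar>c - c'\<bar> / b) * laplace_density b (x - c')"
proof -
  have "- \<bar>x - c\<bar> / b \<le> \<bar>c - c'\<bar> / b + - \<bar>x - c'\<bar> / b"
    using assms by (simp add: field_simps)
  hence "exp (- \<bar>x - c\<bar> / b) \<le> exp (\<bar>c - c'\<bar> / b) * exp (- \<bar>x - c'\<bar> / b)"
    by (simp only: exp_add[symmetric] exp_le_cancel_iff)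
  thus ?thesis
    using assms by (simp add: laplace_density_def field_simps)
qed

text \<open>The substitution \<open>x = c + y\<close> moves the shift from the event to the density.
  Probabilities for different shifts then become integrals over the same set \<open>B\<close> and
  can be compared pointwise.\<close>

lemma emeasure_laplace_shift:
  assumes [measurable]: "B \<in> sets borel"
  shows "emeasure (laplace b) {y. c + y \<in> B} =
    (\<integral>\<^sup>+x. ennreal (laplace_density b (x - c)) * indicator B x \<partial>lborel)"
proof -
  have [measurable]: "laplace_density b \<in> borel_measurable borel"
    unfolding laplace_density_def by measurable
  have "{y. c + y \<in> B} \<in> sets borel"
    by measurable
  hence "emeasure (laplace b) {y. c + y \<in> B} =
      (\<integral>\<^sup>+y. ennreal (laplace_density b y) * indicator B (c + y) \<partial>lborel)"
    by (simp add: laplace_def emeasure_density indicator_def)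
  also have "\<dots> = (\<integral>\<^sup>+x. ennreal (laplace_density b (x - c)) * indicator B x \<partial>lborel)"
    using nn_integral_real_affine[of "\<lambda>x. ennreal (laplace_density b (x - c)) * indicator B x" 1 c]
    by simp
  finally show ?thesis .
qed

lemma emeasure_laplace_shift_le:
  assumes "b > 0" and [measurable]: "B \<in> sets borel"
  shows "emeasure (laplace b) {y. c + y \<in> B} \<le>
    ennreal (exp (\<bar>c - c'\<bar> / b)) * emeasure (laplace b) {y. c' + y \<in> B}"
proof -
  have [measurable]: "laplace_density b \<in> borel_measurable borel"
    unfolding laplace_density_def by measurable
  have "(\<integral>\<^sup>+x. ennreal (laplace_density b (x - c)) * indicator B x \<partial>lborel) \<le>
      (\<integral>\<^sup>+x. ennreal (exp (\<bar>c - c'\<bar> / b)) *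
        (ennreal (laplace_density b (x - c')) * indicator B x) \<partial>lborel)"
    using laplace_density_shift_le[OF assms(1), of _ c c']
    by (intro nn_integral_mono)
       (auto simp: indicator_def ennreal_mult'[symmetric] intro!: ennreal_leI)
  thus ?thesis
    by (simp add: emeasure_laplace_shift nn_integral_cmult)
qed

text \<open>The noises that produce a fixed output form a box, whose product measure is the product
  over its sides. Every output has length \<open>t\<close>, so lists of other lengths have an empty
  preimage.\<close>

lemma emeasure_noisy_edge_counts_singleton:
  fixes V :: "'a pair_pre_digraph list"
  assumes "t \<ge> 1" and "\<epsilon> > 0" and P: "nonneg_rounding P" and V: "V \<in> graph_seqs t"
  shows "emeasure (noisy_edge_counts t \<epsilon> P V) {xs} =
    (if length xs = t
     then \<Prod>j<t. emeasure (laplace (real t / \<epsilon>))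
       {y. real (card (parcs (V ! j))) + y \<in> P -` {xs ! j}}
     else 0)"
proof -
  let ?L = "laplace (real t / \<epsilon>)"
  let ?M = "PiM {..<t} (\<lambda>_. ?L)"
  define c where "c j = real (\<Sum>u\<in>pverts (V ! j). out_degree (with_proj (V ! j)) u)" for j
  \<comment> \<open>The bound on \<open>j\<close> makes \<open>V ! j\<close> an actual entry of
    \<open>V\<close>, hence a finite digraph.\<close>
  have c: "c j = real (card (parcs (V ! j)))" if "j < t" for j
    using V that unfolding c_def graph_seqs_def
    by (subst sum_out_degree_eq_card_parcs) auto
  interpret L: prob_space ?L
    using assms by (intro prob_space_laplace) auto
  interpret product_prob_space "\<lambda>_. ?L" "{..<t}" ..
  have [measurable]: "P \<in> measurable borel (count_space UNIV)"
    by (rule measurable_nonneg_rounding) fact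
  define f where "f Y = map (\<lambda>j. P (c j + Y j)) [0..<t]" for Y
  define B where "B xs j = {y. P (c j + y) = xs ! j}" for xs j
  have B: "B xs j \<in> sets borel" for xs j
    unfolding B_def by measurable
  have vimage_f: "f -` {xs} \<inter> space ?M = (if length xs = t then PiE {..<t} (B xs) else {})" for xs
  proof (cases "length xs = t")
    case True
    have "f Y = xs \<longleftrightarrow> (\<forall>j<t. Y j \<in> B xs j)" for Y
      using True by (simp add: f_def B_def list_eq_iff_nth_eq)
    \<comment> \<open>Points of \<open>space ?M\<close> are extensional, as \<open>PiE\<close>
      demands, so the preimage is exactly the box.\<close>
    moreover have "space ?M = PiE {..<t} (\<lambda>_. UNIV)"
      by (simp add: space_PiM laplace_def)
    ultimately show ?thesis
      using True by (auto simp: PiE_iff)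
  qed (auto simp: f_def)
  \<comment> \<open>Integer lists are countable, so measurability need only be checked on preimages
    of singletons.\<close>
  have f: "f \<in> measurable ?M (count_space UNIV)"
    by (auto simp: measurable_count_space_eq2_countable vimage_f B intro!: sets_PiM_I_finite)
  have "emeasure (noisy_edge_counts t \<epsilon> P V) {xs} = emeasure ?M (f -` {xs} \<inter> space ?M)"
    unfolding noisy_edge_counts_def c_def[symmetric] f_def[symmetric]
    using f by (rule emeasure_distr) simp
  also have "\<dots> = (if length xs = t then \<Prod>j<t. emeasure ?L (B xs j) else 0)"
    using B by (simp add: vimage_f emeasure_PiM)
  also have "(\<Prod>j<t. emeasure ?L (B xs j)) =
      (\<Prod>j<t. emeasure ?L {y. real (card (parcs (V ! j))) + y \<in> P -` {xs ! j}})"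
    by (intro prod.cong) (auto simp: c B_def)
  finally show ?thesis .
qed

lemma emeasure_noisy_edge_counts_singleton_le:
  fixes V V' :: "'a pair_pre_digraph list"
  assumes "t \<ge> 1" and "\<epsilon> > 0" and P: "nonneg_rounding P"
    and V: "V \<in> graph_seqs t" and V': "V' \<in> graph_seqs t"
    and VV': "edge_neighboring_seqs V V'"
  shows "emeasure (noisy_edge_counts t \<epsilon> P V) {xs} \<le>
    ennreal (exp \<epsilon>) * emeasure (noisy_edge_counts t \<epsilon> P V') {xs}"
proof -
  define b where "b = real t / \<epsilon>"
  define p where "p W j = emeasure (laplace b) {y. real (card (parcs (W ! j))) + y \<in> P -` {xs ! j}}"
    for W :: "'a pair_pre_digraph list" and j
  have "b > 0"
    using assms by (simp add: b_def)
  have [measurable]: "P \<in> measurable borel (count_space UNIV)"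
    by (rule measurable_nonneg_rounding) fact
  have "P -` {k} \<in> sets borel" for k
    using measurable_sets[of P borel "count_space UNIV" "{k}"] by simp
  have step: "p V j \<le> ennreal (exp (\<epsilon> / real t)) * p V' j" if "j < t" for j
  proof -
    let ?n = "\<lambda>W. real (card (parcs (W ! j)))"
    have fin: "pair_fin_digraph (V ! j)" "pair_fin_digraph (V' ! j)"
      using V V' that by (auto simp: graph_seqs_def)
    have "V ! j = V' ! j \<or> edge_neighboring (V ! j) (V' ! j)"
      using VV' V that by (auto simp: edge_neighboring_seqs_def graph_seqs_def list_all2_conv_all_nth)
    hence "\<bar>?n V - ?n V'\<bar> \<le> 1"
      using abs_diff_card_parcs_le_1 fin[THEN pair_fin_digraph.pair_finite_arcs] by fastforce
    \<comment> \<open>By the choice of scale, \<open>1 / b\<close> equals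
      \<open>\<epsilon> / real t\<close>, the share of one week in the privacy budget.\<close>
    hence "\<bar>?n V - ?n V'\<bar> / b \<le> 1 / b"
      using \<open>b > 0\<close> by (intro divide_right_mono) auto
    hence "ennreal (exp (\<bar>?n V - ?n V'\<bar> / b)) \<le> ennreal (exp (\<epsilon> / real t))"
      by (intro ennreal_leI) (simp add: b_def)
    moreover have "p V j \<le> ennreal (exp (\<bar>?n V - ?n V'\<bar> / b)) * p V' j"
      unfolding p_def by (rule emeasure_laplace_shift_le) fact+
    ultimately show ?thesis
      by (meson mult_right_mono order_trans zero_le)
  qed
  have "(\<Prod>j<t. p V j) \<le> (\<Prod>j<t. ennreal (exp (\<epsilon> / real t)) * p V' j)"
    using step by (intro prod_mono_ennreal) auto
  \<comment> \<open>The \<open>t\<close> equal factors multiply to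
    \<open>exp (t * (\<epsilon> / t))\<close>, which is \<open>exp \<epsilon>\<close> since
    \<open>t\<close> is nonzero.\<close>
  also have "\<dots> = ennreal (exp \<epsilon>) * (\<Prod>j<t. p V' j)"
    using \<open>t \<ge> 1\<close> by (simp add: prod.distrib ennreal_power flip: exp_of_nat_mult)
  \<comment> \<open>If \<open>xs\<close> does not have length \<open>t\<close>, both sides are
    0.\<close>
  finally show ?thesis
    unfolding emeasure_noisy_edge_counts_singleton[OF assms(1-3) V]
      emeasure_noisy_edge_counts_singleton[OF assms(1-3) V']
    by (simp add: p_def b_def)
qed

theorem theorem3:
  fixes t :: nat and \<epsilon> :: real and P :: "real \<Rightarrow> int"
  assumes "t \<ge> 1" and "\<epsilon> > 0" and "nonneg_rounding P"
  shows "edge_differentially_private t \<epsilon>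
    (noisy_edge_counts t \<epsilon> P :: 'a pair_pre_digraph list \<Rightarrow> int list measure)"
  unfolding edge_differentially_private_def
proof (intro ballI allI impI)
  fix V V' :: "'a pair_pre_digraph list" and S
  assume "V \<in> graph_seqs t" "V' \<in> graph_seqs t" "edge_neighboring_seqs V V'"
  note le = emeasure_noisy_edge_counts_singleton_le[OF assms this]
  let ?A = "noisy_edge_counts t \<epsilon> P V" and ?A' = "noisy_edge_counts t \<epsilon> P V'"
  interpret A: prob_space ?A
    using assms by (rule prob_space_noisy_edge_counts)
  interpret A': prob_space ?A'
    using assms by (rule prob_space_noisy_edge_counts)
  \<comment> \<open>The integral over \<open>count_space S\<close> is a sum over the countable set
    \<open>S\<close>, all of whose points are events.\<close>
  have "emeasure ?A S = (\<integral>\<^sup>+x. emeasure ?A {x} \<partial>count_space S)"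
    by (rule emeasure_countable_singleton) auto
  also have "\<dots> \<le> (\<integral>\<^sup>+x. ennreal (exp \<epsilon>) * emeasure ?A' {x} \<partial>count_space S)"
    by (intro nn_integral_mono le)
  also have "\<dots> = ennreal (exp \<epsilon>) * (\<integral>\<^sup>+x. emeasure ?A' {x} \<partial>count_space S)"
    by (rule nn_integral_cmult) simp
  also have "(\<integral>\<^sup>+x. emeasure ?A' {x} \<partial>count_space S) = emeasure ?A' S"
    by (rule emeasure_countable_singleton[symmetric]) auto
  \<comment> \<open>Both measures are finite, so the inequality passes from \<open>ennreal\<close>
    to the reals.\<close>
  finally show "measure ?A S \<le> exp \<epsilon> * measure ?A' S"
    by (simp add: A.emeasure_eq_measure A'.emeasure_eq_measure ennreal_mult'[symmetric])
qed

end
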